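(* Let $n,m\ge 1$, $T>0$, $X_0\in\mathbb{R}^n$, and let $A\in\mathbb{R}^{n\times n}$ have only real eigenvalues. Let $\mathcal{U}\subset\mathbb{R}^m$ be a compact convex polytope with $0\in\mathcal{U}$, given as the convex hull of finitely many vertices $u_1,\dots,u_N\in\mathbb{R}^m$. Let $\mathcal{B}\subset\mathbb{R}^{n\times m}$ be compact. Let $d\in\mathbb{R}^n$ with $\|d\|=1$ be an eigenvector of $A^\top$ (with real eigenvalue). Define $P_0 := e^{A^\top T} d$. For each $i\in\{1,\dots,N\}$ choose $$B_i \in \arg\max_{B\in\mathcal{B}} P_0^\top B u_i,$$ and choose $$i^\ast \in \arg\max_{1\le i\le N} P_0^\top B_i u_i .$$ Then $B^\ast := B_{i^\ast}$ satisfies $B^\ast\in\arg\max_{B\in\mathcal{B}} G_d(B)$, where $G_d$ is the directional growth metric defined in the context.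
   Context: For a fixed $B\in\mathcal{B}$ consider the linear control system $\dot X(t)=AX(t)+Bu(t)$, $X(0)=X_0$, $t\in[0,T]$, with measurable controls $u(t)\in\mathcal{U}$. The co-state with terminal condition $P(T)=d$ is $P(t)=e^{A^\top (T-t)}d$, i.e. the solution of $\dot P(t)=-A^\top P(t)$, $P(T)=d$. Let $u_B^\ast(\cdot)$ be any admissible control satisfying $u_B^\ast(t)\in\arg\max_{u\in\mathcal{U}} P(t)^\top B u$ for all $t\in[0,T]$ (the Pontryagin maximum-principle control for the boundary trajectory with terminal co-state $d$), and let $X_{d,B}:=X(T)$ denote the terminal state of the trajectory driven by $u_B^\ast$. Let $c_0:=e^{AT}X_0$ be the endpoint at time $T$ of the zero-input trajectory ($u\equiv 0$). The directional growth metric is $$G_d(B):= d^\top\big(X_{d,B}-c_0\big).$$ *)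

theory Defs
  imports "HOL-Analysis.Analysis"
begin

text \<open>Matrix powers and the matrix exponential e^M = sum_k M^k / k!.\<close>

primrec mat_pow :: "real ^'n^'n \<Rightarrow> nat \<Rightarrow> real ^'n^'n" where
  "mat_pow M 0 = mat 1"
| "mat_pow M (Suc k) = M ** mat_pow M k"

definition mat_exp :: "real ^'n^'n \<Rightarrow> real ^'n^'n" where
  "mat_exp M = (\<Sum>k. (1 / fact k) *\<^sub>R mat_pow M k)"

text \<open>A real square matrix has only real eigenvalues (eigenvalues taken over the complex numbers).\<close>

definition only_real_eigenvalues :: "real ^'n^'n \<Rightarrow> bool" where
  "only_real_eigenvalues A \<longleftrightarrow>
     (\<forall>(z::complex) (v::complex^'n). v \<noteq> 0 \<and>
        (\<chi> i j. complex_of_real (A $ i $ j)) *v v = z *s v \<longrightarrow> z \<in> \<real>)"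

text \<open>Admissible control on [0,T]: Lebesgue measurable with values in U.\<close>

definition admissible :: "real \<Rightarrow> (real ^'m) set \<Rightarrow> (real \<Rightarrow> real ^'m) \<Rightarrow> bool" where
  "admissible T U u \<longleftrightarrow> u \<in> borel_measurable (lebesgue_on {0..T}) \<and> (\<forall>t\<in>{0..T}. u t \<in> U)"

text \<open>Co-state P(t) = e^{A^T (T-t)} d.\<close>

definition costate :: "real ^'n^'n \<Rightarrow> real \<Rightarrow> real ^'n \<Rightarrow> real \<Rightarrow> real ^'n" where
  "costate A T d t = mat_exp ((T - t) *\<^sub>R transpose A) *v d"

text \<open>Pontryagin maximum-principle control for B with terminal co-state d.\<close>

definition pmp_control ::
  "real ^'n^'n \<Rightarrow> real ^'m^'n \<Rightarrow> real \<Rightarrow> (real ^'m) set \<Rightarrow> real ^'n \<Rightarrow> (real \<Rightarrow> real ^'m) \<Rightarrow> bool" where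
  "pmp_control A B T U d u \<longleftrightarrow> admissible T U u \<and>
     (\<forall>t\<in>{0..T}. \<forall>v\<in>U. costate A T d t \<bullet> (B *v v) \<le> costate A T d t \<bullet> (B *v u t))"

text \<open>Terminal state of dX = AX + Bu, X(0)=X0 (variation-of-constants / mild solution).\<close>

definition terminal_state ::
  "real ^'n^'n \<Rightarrow> real ^'m^'n \<Rightarrow> real ^'n \<Rightarrow> real \<Rightarrow> (real \<Rightarrow> real ^'m) \<Rightarrow> real ^'n" where
  "terminal_state A B X0 T u =
     mat_exp (T *\<^sub>R A) *v X0 + integral {0..T} (\<lambda>s. mat_exp ((T - s) *\<^sub>R A) *v (B *v u s))"

text \<open>Directional growth metric G_d(B) = d^T (X_{d,B} - c_0), for the PMP control u.\<close>

definition growth_metric ::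
  "real ^'n^'n \<Rightarrow> real ^'m^'n \<Rightarrow> real ^'n \<Rightarrow> real \<Rightarrow> real ^'n \<Rightarrow> (real \<Rightarrow> real ^'m) \<Rightarrow> real" where
  "growth_metric A B X0 T d u = d \<bullet> (terminal_state A B X0 T u - mat_exp (T *\<^sub>R A) *v X0)"

end

theory Submission
  imports Defs
begin

(*
  Since d is an eigenvector of A^T, say A^T d = lam d, we have d^T e^(sA) = e^(s lam) d^T.
  Hence the co-state is a positive multiple of d, every PMP control maximises u |-> d^T B u
  over U at each time, and G_d(B) = int_0^T e^((T-s) lam) d^T B u(s) ds.  A linear functional
  on the polytope U attains its maximum at a vertex, so for every B in the family the integrand
  is bounded by e^((T-s) lam) d^T B_i* u_i*, which in turn is bounded by the integrand of B_i*
  and its PMP control.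
*)

definition mat_onorm :: "real^'m^'n \<Rightarrow> real" where
  "mat_onorm M = onorm ((*v) M)"

lemma mat_onorm_nonneg: "0 \<le> mat_onorm M"
  unfolding mat_onorm_def by (rule onorm_pos_le[OF matrix_vector_mul_bounded_linear])

lemma norm_matrix_vector_mult_le: "norm (M *v x) \<le> mat_onorm M * norm x"
  unfolding mat_onorm_def by (rule onorm[OF matrix_vector_mul_bounded_linear])

lemma mat_onorm_mult: "mat_onorm (M ** P) \<le> mat_onorm M * mat_onorm P"
proof -
  have "(*v) (M ** P) = (*v) M \<circ> (*v) P"
    by (auto simp: fun_eq_iff matrix_vector_mul_assoc)
  then show ?thesis
    unfolding mat_onorm_def
    using onorm_compose[OF matrix_vector_mul_bounded_linear matrix_vector_mul_bounded_linear]
    by simp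
qed

lemma mat_onorm_scaleR: "mat_onorm (c *\<^sub>R M) = \<bar>c\<bar> * mat_onorm M"
proof -
  have "(*v) (c *\<^sub>R M) = (\<lambda>x. c *\<^sub>R (M *v x))"
    by (simp add: fun_eq_iff scaleR_matrix_vector_assoc)
  then show ?thesis
    unfolding mat_onorm_def by (simp add: onorm_scaleR)
qed

lemma mat_onorm_mat_pow: "mat_onorm (mat_pow M k) \<le> mat_onorm M ^ k"
proof (induction k)
  case 0
  have mat_1_id: "(*v) (mat 1 :: real^'n^'n) = (\<lambda>x. x)"
    by (simp add: fun_eq_iff)
  show ?case
    unfolding mat_onorm_def mat_pow.simps(1) power_0 mat_1_id by (rule onorm_id_le)
next
  case (Suc k)
  have "mat_onorm (mat_pow M (Suc k)) \<le> mat_onorm M * mat_onorm (mat_pow M k)"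
    using mat_onorm_mult by simp
  also have "\<dots> \<le> mat_onorm M ^ Suc k"
    using Suc mat_onorm_nonneg[of M] by (simp add: mult_left_mono)
  finally show ?case .
qed

lemma norm_le_mat_onorm: "norm (M :: real^'m^'n) \<le> real CARD('n) * real CARD('m) * mat_onorm M"
proof -
  have "norm M = L2_set (\<lambda>i. norm (M $ i)) UNIV"
    by (simp add: norm_vec_def)
  also have "\<dots> \<le> (\<Sum>i\<in>UNIV. norm (M $ i))"
    by (rule L2_set_le_sum) simp
  also have "\<dots> \<le> (\<Sum>i\<in>(UNIV::'n set). \<Sum>j\<in>UNIV. \<bar>M $ i $ j\<bar>)"
    by (rule sum_mono) (rule norm_le_l1_cart)
  also have "\<dots> \<le> (\<Sum>i\<in>(UNIV::'n set). \<Sum>j\<in>(UNIV::'m set). mat_onorm M)"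
    by (intro sum_mono) (simp add: mat_onorm_def matrix_component_le_onorm)
  finally show ?thesis
    by simp
qed

lemma mat_pow_scaleR: "mat_pow (c *\<^sub>R M) k = c ^ k *\<^sub>R mat_pow M k"
  by (induction k) (simp_all add: scalar_matrix_assoc[symmetric] matrix_scalar_ac)

lemma summable_mat_exp: "summable (\<lambda>k. (1 / fact k) *\<^sub>R mat_pow (M :: real^'n^'n) k)"
proof (rule summable_comparison_test)
  let ?C = "real CARD('n) * real CARD('n)"
  show "summable (\<lambda>k. ?C * (mat_onorm M ^ k / fact k))"
    using summable_exp_generic[of "mat_onorm M"]
    by (intro summable_mult) (simp add: divide_inverse mult.commute)
  have "norm ((1 / fact k) *\<^sub>R mat_pow M k) \<le> ?C * (mat_onorm M ^ k / fact k)" for k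
  proof -
    have "norm (mat_pow M k) \<le> ?C * mat_onorm M ^ k"
      using norm_le_mat_onorm[of "mat_pow M k"] mat_onorm_mat_pow[of M k]
      by (meson order_trans mult_left_mono of_nat_0_le_iff mult_nonneg_nonneg)
    then show ?thesis
      by (simp add: divide_right_mono)
  qed
  then show "\<exists>N. \<forall>k\<ge>N. norm ((1 / fact k) *\<^sub>R mat_pow M k) \<le> ?C * (mat_onorm M ^ k / fact k)"
    by blast
qed

lemma bounded_linear_mat_exp_sums:
  assumes "bounded_linear L"
  shows "(\<lambda>k. (1 / fact k) *\<^sub>R L (mat_pow M k)) sums L (mat_exp M)"
  using bounded_linear.sums[OF assms summable_sums[OF summable_mat_exp]]
  by (simp add: mat_exp_def linear_scale[OF bounded_linear.linear[OF assms]])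

lemma bounded_linear_mat_exp_eigen:
  assumes "bounded_linear L" and "\<And>k. L (mat_pow M k) = \<mu> ^ k *\<^sub>R v"
  shows "L (mat_exp M) = exp \<mu> *\<^sub>R v"
proof -
  have "(\<lambda>k. (\<mu> ^ k /\<^sub>R fact k) *\<^sub>R v) sums (exp \<mu> *\<^sub>R v)"
    by (rule sums_scaleR_left[OF exp_converges])
  moreover have "(\<lambda>k. (\<mu> ^ k /\<^sub>R fact k) *\<^sub>R v) sums L (mat_exp M)"
    using bounded_linear_mat_exp_sums[OF assms(1), of M] by (simp add: assms(2) divide_inverse mult.commute)
  ultimately show ?thesis
    using sums_unique2 by blast
qed

lemma bounded_linear_matrix_vector_mult_left: "bounded_linear (\<lambda>M :: real^'m^'n. M *v x)"
  by (simp add: linear_conv_bounded_linear[symmetric] linearI matrix_vector_mult_add_rdistrib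
      scaleR_matrix_vector_assoc)

lemma bounded_linear_vector_matrix_mult_right: "bounded_linear (\<lambda>M :: real^'m^'n. x v* M)"
  by (simp add: linear_conv_bounded_linear[symmetric] linearI vector_matrix_mult_add_rdistrib
      vector_scaleR_matrix_ac)

lemma mat_exp_mult_eigenvector:
  assumes "M *v v = \<mu> *\<^sub>R v"
  shows "mat_exp M *v v = exp \<mu> *\<^sub>R v"
proof (rule bounded_linear_mat_exp_eigen[OF bounded_linear_matrix_vector_mult_left])
  show "mat_pow M k *v v = \<mu> ^ k *\<^sub>R v" for k
    by (induction k) (simp_all add: matrix_vector_mul_assoc[symmetric] matrix_vector_mult_scaleR assms)
qed

lemma eigenvector_mult_mat_exp:
  assumes "v v* M = \<mu> *\<^sub>R v"
  shows "v v* mat_exp M = exp \<mu> *\<^sub>R v"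
proof (rule bounded_linear_mat_exp_eigen[OF bounded_linear_vector_matrix_mult_right])
  show "v v* mat_pow M k = \<mu> ^ k *\<^sub>R v" for k
    by (induction k) (simp_all add: vector_matrix_mul_assoc[symmetric] assms scaleR_vector_matrix_assoc)
qed

lemma norm_mat_exp_mult_le: "norm (mat_exp M *v x) \<le> exp (mat_onorm M) * norm x"
proof (rule norm_sums_le)
  show "(\<lambda>k. (1 / fact k) *\<^sub>R (mat_pow M k *v x)) sums (mat_exp M *v x)"
    by (rule bounded_linear_mat_exp_sums[OF bounded_linear_matrix_vector_mult_left])
  show "(\<lambda>k. (mat_onorm M ^ k /\<^sub>R fact k) * norm x) sums (exp (mat_onorm M) * norm x)"
    by (rule sums_mult2[OF exp_converges])
  show "norm ((1 / fact k) *\<^sub>R (mat_pow M k *v x)) \<le> (mat_onorm M ^ k /\<^sub>R fact k) * norm x" for k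
  proof -
    have "norm (mat_pow M k *v x) \<le> mat_onorm M ^ k * norm x"
      using norm_matrix_vector_mult_le[of "mat_pow M k" x] mat_onorm_mat_pow[of M k]
      by (meson mult_right_mono norm_ge_zero order_trans)
    then show ?thesis
      by (simp add: divide_right_mono divide_inverse mult_ac)
  qed
qed

lemma borel_measurable_mat_exp_scaleR:
  "(\<lambda>c. mat_exp (c *\<^sub>R (M :: real^'n^'n))) \<in> borel_measurable borel"
proof (rule borel_measurable_LIMSEQ_metric)
  let ?S = "\<lambda>N c. \<Sum>k<N. (c ^ k / fact k) *\<^sub>R mat_pow M k"
  show "?S N \<in> borel_measurable borel" for N
    by (intro borel_measurable_continuous_onI continuous_intros) simp
  show "(\<lambda>N. ?S N c) \<longlonglongrightarrow> mat_exp (c *\<^sub>R M)" for c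
    using summable_LIMSEQ[OF summable_mat_exp[of "c *\<^sub>R M"]]
    by (simp add: mat_exp_def mat_pow_scaleR)
qed

lemma integrable_variation_of_constants:
  fixes A :: "real^'n^'n" and B :: "real^'m^'n"
  assumes "admissible T U u" and "bounded U"
  shows "(\<lambda>s. mat_exp ((T - s) *\<^sub>R A) *v (B *v u s)) integrable_on {0..T}"
proof -
  let ?f = "\<lambda>s. mat_exp ((T - s) *\<^sub>R A) *v (B *v u s)"
  have u_meas: "u \<in> borel_measurable (lebesgue_on {0..T})" and u_U: "\<And>t. t \<in> {0..T} \<Longrightarrow> u t \<in> U"
    using assms(1) by (auto simp: admissible_def)
  obtain R where R: "\<And>v. v \<in> U \<Longrightarrow> norm v \<le> R"
    using assms(2) by (auto simp: bounded_iff)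
  have exp_meas: "(\<lambda>s. mat_exp ((T - s) *\<^sub>R A)) \<in> borel_measurable (lebesgue_on {0..T})"
    by (rule measurable_compose[OF _ borel_measurable_mat_exp_scaleR])
      (intro continuous_imp_measurable_on_sets_lebesgue continuous_intros; simp)
  have Bu_meas: "(\<lambda>s. B *v u s) \<in> borel_measurable (lebesgue_on {0..T})"
    by (rule measurable_compose[OF u_meas]) (intro borel_measurable_continuous_onI continuous_intros)
  have mult_cont: "continuous_on UNIV (\<lambda>x. fst x *v (snd x :: real^'n) :: real^'n)"
    unfolding matrix_vector_mult_def by (intro continuous_intros)
  have f_meas: "?f \<in> borel_measurable (lebesgue_on {0..T})"
    using borel_measurable_continuous_Pair[OF exp_meas Bu_meas mult_cont] by simp
  have f_bound: "norm (?f s) \<le> exp (T * mat_onorm A) * (mat_onorm B * R)" if "s \<in> {0..T}" for s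
  proof -
    have "norm (?f s) \<le> exp (\<bar>T - s\<bar> * mat_onorm A) * norm (B *v u s)"
      using norm_mat_exp_mult_le[of "(T - s) *\<^sub>R A"] by (simp add: mat_onorm_scaleR)
    also have "\<dots> \<le> exp (T * mat_onorm A) * (mat_onorm B * R)"
    proof (intro mult_mono)
      show "exp (\<bar>T - s\<bar> * mat_onorm A) \<le> exp (T * mat_onorm A)"
        using that mat_onorm_nonneg[of A] by (simp add: mult_right_mono)
      show "norm (B *v u s) \<le> mat_onorm B * R"
        using norm_matrix_vector_mult_le[of B "u s"] R[OF u_U[OF that]] mat_onorm_nonneg[of B]
        by (meson mult_left_mono order_trans)
    qed simp_all
    finally show ?thesis .
  qed
  have "?f absolutely_integrable_on {0..T}"
    by (rule measurable_bounded_by_integrable_imp_absolutely_integrable[OF f_meas _ _ f_bound]) auto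
  then show ?thesis
    using set_lebesgue_integral_eq_integral(1) by blast
qed

lemma has_integral_growth_metric:
  assumes "admissible T U u" and "bounded U"
  shows "((\<lambda>s. d \<bullet> (mat_exp ((T - s) *\<^sub>R A) *v (B *v u s))) has_integral growth_metric A B X0 T d u)
    {0..T}"
  using has_integral_linear[OF integrable_integral[OF integrable_variation_of_constants[OF assms]]
      bounded_linear_inner_right[of d]]
  by (simp add: growth_metric_def terminal_state_def o_def)

lemma has_integral_growth_metric_eigenvector:
  assumes "admissible T U u" and "bounded U" and "transpose A *v d = lam *\<^sub>R d"
  shows "((\<lambda>s. exp ((T - s) * lam) * (d \<bullet> (B *v u s))) has_integral growth_metric A B X0 T d u) {0..T}"
proof -
  have "d v* A = lam *\<^sub>R d"
    using assms(3) by simp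
  then have "d v* mat_exp ((T - s) *\<^sub>R A) = exp ((T - s) * lam) *\<^sub>R d" for s
    by (intro eigenvector_mult_mat_exp) (simp add: vector_scaleR_matrix_ac)
  then have "d \<bullet> (mat_exp ((T - s) *\<^sub>R A) *v w) = exp ((T - s) * lam) * (d \<bullet> w)" for s w
    by (simp flip: dot_lmul_matrix)
  then show ?thesis
    using has_integral_growth_metric[OF assms(1,2), of d A B X0]
    by simp
qed

lemma growth_metric_mono_eigenvector:
  assumes "admissible T U u" and "admissible T U u'" and "bounded U"
    and "transpose A *v d = lam *\<^sub>R d"
    and "\<And>s. s \<in> {0..T} \<Longrightarrow> d \<bullet> (B *v u s) \<le> d \<bullet> (B' *v u' s)"
  shows "growth_metric A B X0 T d u \<le> growth_metric A B' X0 T d u'"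
  using has_integral_growth_metric_eigenvector[OF assms(1,3,4)]
    has_integral_growth_metric_eigenvector[OF assms(2,3,4)]
  by (rule has_integral_le) (simp add: assms(5))

lemma pmp_control_eigenvector_max:
  assumes "pmp_control A B T U d u" and "transpose A *v d = lam *\<^sub>R d"
    and "t \<in> {0..T}" and "v \<in> U"
  shows "d \<bullet> (B *v v) \<le> d \<bullet> (B *v u t)"
proof -
  have "d v* A = lam *\<^sub>R d"
    using assms(2) by simp
  then have "costate A T d t = exp ((T - t) * lam) *\<^sub>R d"
    unfolding costate_def by (intro mat_exp_mult_eigenvector) (simp flip: scaleR_matrix_vector_assoc)
  moreover have "costate A T d t \<bullet> (B *v v) \<le> costate A T d t \<bullet> (B *v u t)"
    using assms(1,3,4) by (simp add: pmp_control_def)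
  ultimately show ?thesis
    by simp
qed

lemma inner_le_on_convex_hull:
  assumes "\<And>x. x \<in> S \<Longrightarrow> a \<bullet> x \<le> c" and "y \<in> convex hull S"
  shows "a \<bullet> y \<le> c"
  using hull_minimal[of S "{x. a \<bullet> x \<le> c}" convex] assms convex_halfspace_le by blast

theorem theorem1:
  fixes A :: "real ^'n^'n" and X0 d :: "real ^'n" and T :: real
    and U :: "(real ^'m) set" and N :: nat and uv :: "nat \<Rightarrow> real ^'m"
    and \<B> :: "(real ^'m^'n) set" and Bi :: "nat \<Rightarrow> real ^'m^'n" and istar :: nat
  assumes T_pos: "T > 0"
    and A_real: "only_real_eigenvalues A"
    and N_pos: "N \<ge> 1"
    and U_hull: "U = convex hull (uv ` {1..N})"
    and zero_U: "0 \<in> U"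
    and B_compact: "compact \<B>"
    and d_norm: "norm d = 1"
    and d_eig: "\<exists>lam::real. transpose A *v d = lam *\<^sub>R d"
    and Bi_mem: "\<forall>i\<in>{1..N}. Bi i \<in> \<B>"
    and Bi_max: "\<forall>i\<in>{1..N}. \<forall>B\<in>\<B>.
        (mat_exp (T *\<^sub>R transpose A) *v d) \<bullet> (B *v uv i)
          \<le> (mat_exp (T *\<^sub>R transpose A) *v d) \<bullet> (Bi i *v uv i)"
    and istar_mem: "istar \<in> {1..N}"
    and istar_max: "\<forall>i\<in>{1..N}.
        (mat_exp (T *\<^sub>R transpose A) *v d) \<bullet> (Bi i *v uv i)
          \<le> (mat_exp (T *\<^sub>R transpose A) *v d) \<bullet> (Bi istar *v uv istar)"
  shows "Bi istar \<in> \<B> \<and>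
    (\<forall>ustar. pmp_control A (Bi istar) T U d ustar \<longrightarrow>
       (\<forall>B\<in>\<B>. \<forall>u. pmp_control A B T U d u \<longrightarrow>
          growth_metric A B X0 T d u \<le> growth_metric A (Bi istar) X0 T d ustar))"
proof -
  obtain lam where lam: "transpose A *v d = lam *\<^sub>R d"
    using d_eig by blast
  let ?Bs = "Bi istar"
  have P0: "mat_exp (T *\<^sub>R transpose A) *v d = exp (T * lam) *\<^sub>R d"
    using lam by (intro mat_exp_mult_eigenvector) (simp flip: scaleR_matrix_vector_assoc)
  have vertex_le: "d \<bullet> (B *v uv i) \<le> d \<bullet> (?Bs *v uv istar)" if "i \<in> {1..N}" "B \<in> \<B>" for i B
    using Bi_max[rule_format, OF that] istar_max[rule_format, OF that(1)] unfolding P0 by auto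
  have U_le: "d \<bullet> (B *v v) \<le> d \<bullet> (?Bs *v uv istar)" if "B \<in> \<B>" "v \<in> U" for B v
    using inner_le_on_convex_hull[of "uv ` {1..N}" "d v* B" "d \<bullet> (?Bs *v uv istar)" v]
      vertex_le that U_hull
    by (force simp: dot_lmul_matrix)
  have bounded_U: "bounded U"
    unfolding U_hull by (intro compact_imp_bounded compact_convex_hull finite_imp_compact) simp
  have istar_U: "uv istar \<in> U"
    unfolding U_hull using istar_mem by (intro hull_inc) simp
  have "growth_metric A B X0 T d u \<le> growth_metric A ?Bs X0 T d ustar"
    if B: "B \<in> \<B>" and u: "pmp_control A B T U d u" and ustar: "pmp_control A ?Bs T U d ustar"
    for B u ustar
  proof (rule growth_metric_mono_eigenvector[OF _ _ bounded_U lam])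
    show "admissible T U u" "admissible T U ustar"
      using u ustar by (simp_all add: pmp_control_def)
    fix s
    assume s: "s \<in> {0..T}"
    then have "u s \<in> U"
      using u by (simp add: pmp_control_def admissible_def)
    then show "d \<bullet> (B *v u s) \<le> d \<bullet> (?Bs *v ustar s)"
      using U_le[OF B] pmp_control_eigenvector_max[OF ustar lam s istar_U] by (meson order_trans)
  qed
  then show ?thesis
    using Bi_mem istar_mem by blast
qed

end
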